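(* Let $m$ and $*$ be binary operations on the set $\mathbb{R}^{+}$ of positive real numbers, and let $e\in\mathbb{R}^{+}$ be an element, such that for all $x,y,z\in\mathbb{R}^{+}$: (M1) $m(x,x)=x$; (M2) $m(x,y)=m(y,x)$; (M3) $m(x,y)=m(z,y)$ implies $x=z$; (M4) $m(x,y)*m(x,y)=x*y$; (M5) $e*x=x$; (M6) $x*x=y*y$ implies $x=y$. Then $m$ is medial, i.e. $m(m(x,y),m(z,u))=m(m(x,z),m(y,u))$ for all $x,y,z,u\in\mathbb{R}^{+}$, if and only if the operation $*$ is associative.
   Context: A binary operation on $\mathbb{R}^{+}$ is an arbitrary map $\mathbb{R}^{+}\times\mathbb{R}^{+}\to\mathbb{R}^{+}$; no continuity or relation to the usual arithmetic of real numbers is assumed. *)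

theory Defs
  imports Complex_Main
begin

(* The set of positive reals is the carrier {0<..}; operations are HOL functions on all reals
   that map the carrier into itself, and nothing is assumed about their values outside it. *)

definition binary_op_on :: "'a set \<Rightarrow> ('a \<Rightarrow> 'a \<Rightarrow> 'a) \<Rightarrow> bool" where
  "binary_op_on A f \<longleftrightarrow> (\<forall>x\<in>A. \<forall>y\<in>A. f x y \<in> A)"

definition medial_on :: "'a set \<Rightarrow> ('a \<Rightarrow> 'a \<Rightarrow> 'a) \<Rightarrow> bool" where
  "medial_on A f \<longleftrightarrow>
     (\<forall>x\<in>A. \<forall>y\<in>A. \<forall>z\<in>A. \<forall>u\<in>A. f (f x y) (f z u) = f (f x z) (f y u))"

definition associative_on :: "'a set \<Rightarrow> ('a \<Rightarrow> 'a \<Rightarrow> 'a) \<Rightarrow> bool" where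
  "associative_on A f \<longleftrightarrow>
     (\<forall>x\<in>A. \<forall>y\<in>A. \<forall>z\<in>A. f (f x y) z = f x (f y z))"

end

(* Write s x = x * x. Then M4 reads x * y = s (m x y), so by M5 the map m e is a right inverse of s, and
   since s is injective by M6 the two maps are mutually inverse. If m is medial, m e is an endomorphism of m,
   hence so is s, and both bracketings of x * y * z become s (s _) of the two sides of a medial identity in
   x, y, z, e. Conversely, if * is associative it is a commutative semigroup, so s is an endomorphism of *,
   and s (s _) of both sides of the medial law is the product x * y * z * u. *)
theory Submission
  imports Defs
begin

lemma medial_on_iff_associative_on:
  fixes m star :: "'a \<Rightarrow> 'a \<Rightarrow> 'a"
  assumes m_op: "binary_op_on A m"
    and star_op: "binary_op_on A star"
    and e_in: "e \<in> A"
    and idem: "\<And>x. x \<in> A \<Longrightarrow> m x x = x"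
    and comm: "\<And>x y. x \<in> A \<Longrightarrow> y \<in> A \<Longrightarrow> m x y = m y x"
    and square_m: "\<And>x y. x \<in> A \<Longrightarrow> y \<in> A \<Longrightarrow> star (m x y) (m x y) = star x y"
    and unit: "\<And>x. x \<in> A \<Longrightarrow> star e x = x"
    and square_inj: "\<And>x y. x \<in> A \<Longrightarrow> y \<in> A \<Longrightarrow> star x x = star y y \<Longrightarrow> x = y"
  shows "medial_on A m \<longleftrightarrow> associative_on A star"
proof -
  define s where "s x = star x x" for x
  have m_cl: "m x y \<in> A" if "x \<in> A" "y \<in> A" for x y
    using m_op that by (simp add: binary_op_on_def)
  have star_cl: "star x y \<in> A" if "x \<in> A" "y \<in> A" for x y
    using star_op that by (simp add: binary_op_on_def)
  have s_cl: "s x \<in> A" if "x \<in> A" for x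
    using star_cl that by (simp add: s_def)
  have s_inj: "x = y" if "s x = s y" "x \<in> A" "y \<in> A" for x y
    using square_inj that by (simp add: s_def)
  have star_eq: "star x y = s (m x y)" if "x \<in> A" "y \<in> A" for x y
    using square_m that by (simp add: s_def)
  \<comment> \<open>Commutativity passes from \<open>m\<close> to \<open>star\<close>, since
    \<open>star x y\<close> depends only on \<open>m x y\<close>.\<close>
  have star_comm: "star x y = star y x" if "x \<in> A" "y \<in> A" for x y
    using comm that by (simp add: star_eq)
  have s_m_e: "s (m e x) = x" if "x \<in> A" for x
    using that e_in unit by (simp flip: star_eq)
  have m_e_s: "m e (s x) = x" if "x \<in> A" for x
    using that e_in by (metis s_inj s_m_e m_cl s_cl)
  show ?thesis
  proof
    assume "medial_on A m"
    then have med: "m (m x y) (m z u) = m (m x z) (m y u)"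
      if "x \<in> A" "y \<in> A" "z \<in> A" "u \<in> A" for x y z u
      using that by (simp add: medial_on_def)
    have s_hom: "s (m x y) = m (s x) (s y)" if P: "x \<in> A" "y \<in> A" for x y
    proof -
      \<comment> \<open>Idempotence lets \<open>e\<close> be read as \<open>m e e\<close>, so
        mediality distributes \<open>m e\<close> over \<open>m\<close>; applying \<open>s\<close> at
        the end undoes \<open>m e\<close>.\<close>
      have "m e (m (s x) (s y)) = m (m e (s x)) (m e (s y))"
        using med[of e e "s x" "s y"] idem[OF e_in] P e_in s_cl by simp
      also have "\<dots> = m x y"
        using P m_e_s by simp
      finally show ?thesis
        using s_m_e[of "m (s x) (s y)"] P s_cl m_cl by metis
    qed
    have star_star: "star (star x y) z = s (s (m (m x y) (m e z)))"
      if P: "x \<in> A" "y \<in> A" "z \<in> A" for x y z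
    proof -
      \<comment> \<open>Writing \<open>z\<close> as \<open>s (m e z)\<close> makes both factors
        values of \<open>s\<close>, so that \<open>s_hom\<close> can pull \<open>s\<close>
        out.\<close>
      have "star (star x y) z = s (m (s (m x y)) (s (m e z)))"
        using P s_cl m_cl by (simp add: star_eq s_m_e)
      also have "\<dots> = s (s (m (m x y) (m e z)))"
        using P e_in m_cl by (simp add: s_hom)
      finally show ?thesis .
    qed
    show "associative_on A star"
      unfolding associative_on_def
    proof (intro ballI)
      fix x y z assume P: "x \<in> A" "y \<in> A" "z \<in> A"
      \<comment> \<open>Mediality exchanges \<open>y\<close> and \<open>e\<close>; commutativity
        then gives the term that \<open>star_star\<close> attaches to the cyclic shift
        \<open>y\<close>, \<open>z\<close>, \<open>x\<close>.\<close>
      have "m (m x y) (m e z) = m (m x e) (m y z)"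
        using P e_in by (intro med)
      also have "\<dots> = m (m y z) (m e x)"
        using P e_in m_cl comm by metis
      finally have "star (star x y) z = star (star y z) x"
        using P by (simp only: star_star)
      then show "star (star x y) z = star x (star y z)"
        using P star_cl star_comm by metis
    qed
  next
    assume "associative_on A star"
    then have assoc: "star (star x y) z = star x (star y z)"
      if "x \<in> A" "y \<in> A" "z \<in> A" for x y z
      using that by (simp add: associative_on_def)
    \<comment> \<open>The medial law for \<open>star\<close> itself, as in any commutative
      semigroup: with brackets moved to the right, only \<open>y\<close> and \<open>z\<close> trade
      places.\<close>
    have interchange: "star (star x y) (star z u) = star (star x z) (star y u)"
      if P: "x \<in> A" "y \<in> A" "z \<in> A" "u \<in> A" for x y z u
    proof -
      have "star y (star z u) = star z (star y u)"
        using P assoc[of y z u] assoc[of z y u] star_comm[of y z] by simp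
      then show ?thesis
        using P star_cl by (simp add: assoc)
    qed
    have s_s_m: "s (s (m (m x y) (m z u))) = star (star x y) (star z u)"
      if P: "x \<in> A" "y \<in> A" "z \<in> A" "u \<in> A" for x y z u
    proof -
      have "s (s (m (m x y) (m z u))) = s (star (m x y) (m z u))"
        using P m_cl by (simp add: star_eq)
      \<comment> \<open>This is \<open>interchange\<close> in the form (a*b)*(a*b) = (a*a)*(b*b),
        with a = \<open>m x y\<close> and b = \<open>m z u\<close>.\<close>
      also have "\<dots> = star (s (m x y)) (s (m z u))"
        unfolding s_def using P m_cl by (intro interchange)
      also have "\<dots> = star (star x y) (star z u)"
        using P by (simp add: star_eq)
      finally show ?thesis .
    qed
    show "medial_on A m"
      unfolding medial_on_def
    proof (intro ballI)
      fix x y z u assume P: "x \<in> A" "y \<in> A" "z \<in> A" "u \<in> A"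
      \<comment> \<open>Both sides are products of the same four factors, equal by
        \<open>interchange\<close>; injectivity then cancels \<open>s\<close> twice.\<close>
      have "s (s (m (m x y) (m z u))) = s (s (m (m x z) (m y u)))"
        using interchange P by (simp only: s_s_m)
      then show "m (m x y) (m z u) = m (m x z) (m y u)"
        using P m_cl s_cl s_inj by metis
    qed
  qed
qed

theorem theorem3:
  fixes m star :: "real \<Rightarrow> real \<Rightarrow> real" and e :: real
  assumes m_op: "binary_op_on {0<..} m"
    and star_op: "binary_op_on {0<..} star"
    and e_pos: "e \<in> {0<..}"
    and M1: "\<And>x. x \<in> {0<..} \<Longrightarrow> m x x = x"
    and M2: "\<And>x y. x \<in> {0<..} \<Longrightarrow> y \<in> {0<..} \<Longrightarrow> m x y = m y x"
    and M3: "\<And>x y z. x \<in> {0<..} \<Longrightarrow> y \<in> {0<..} \<Longrightarrow> z \<in> {0<..} \<Longrightarrow> m x y = m z y \<Longrightarrow> x = z"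
    and M4: "\<And>x y. x \<in> {0<..} \<Longrightarrow> y \<in> {0<..} \<Longrightarrow> star (m x y) (m x y) = star x y"
    and M5: "\<And>x. x \<in> {0<..} \<Longrightarrow> star e x = x"
    and M6: "\<And>x y. x \<in> {0<..} \<Longrightarrow> y \<in> {0<..} \<Longrightarrow> star x x = star y y \<Longrightarrow> x = y"
  shows "medial_on {0<..} m \<longleftrightarrow> associative_on {0<..} star"
  using assms by (intro medial_on_iff_associative_on[of _ _ _ e])

end
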